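(* Let $\varphi(z)=1+B_1z+B_2z^2+\cdots$ be a Ma–Minda function, let $f\in\mathscr{S}^*(\varphi)$, and let $f^{-1}(\omega)=\omega+\sum_{n=2}^{\infty}A_n\omega^n$ in some neighbourhood of the origin. Then for every complex number $\mu$, $$|A_3-\mu A_2^2|\leq\frac{B_1}{2}\max\{1,|\nu-1|\},\qquad\text{where}\qquad \nu=\frac{1}{B_1}\big((3-2\mu)B_1^2+B_1-B_2\big).$$ In particular, $$|A_2|\leq B_1\quad\text{and}\quad |A_3|\leq\frac{B_1}{2}\max\left\{1,\frac{1}{B_1}|3B_1^2-B_2|\right\}.$$ The bounds are sharp, i.e. for each of these bounds (for given $\varphi$ and, where relevant, $\mu$) there is a function $f\in\mathscr{S}^*(\varphi)$ for which equality holds.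
   Context: $\mathbb{D}=\{z\in\mathbb{C}:|z|<1\}$. $\mathscr{A}$ is the class of functions $f$ analytic in $\mathbb{D}$ with $f(0)=0$, $f'(0)=1$. For analytic $F,G:\mathbb{D}\to\mathbb{C}$, $F\prec G$ (subordination) means that $F(z)=G(w(z))$ in $\mathbb{D}$ for some analytic $w:\mathbb{D}\to\mathbb{D}$ with $w(0)=0$. A Ma–Minda function $\varphi$ is a function analytic and univalent in $\mathbb{D}$ with positive real part, such that $\varphi(0)=1$, $\varphi'(0)>0$, and $\varphi(\mathbb{D})$ is symmetric with respect to the real axis and starlike with respect to $\varphi(0)=1$; its Taylor coefficients are denoted $\varphi(z)=1+B_1z+B_2z^2+\cdots$ (so $B_1>0$). The class $\mathscr{S}^*(\varphi)$ is $\{f\in\mathscr{A}: zf'(z)/f(z)\prec\varphi(z)\}$, where $zf'(z)/f(z)$ is given the value $1$ at $z=0$. $f^{-1}$ denotes the local inverse of $f$ near the origin with $f^{-1}(0)=0$. *)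

theory Defs
  imports "HOL-Complex_Analysis.Complex_Analysis"
begin

abbreviation unit_disc :: "complex set" where
  "unit_disc \<equiv> ball 0 1"

definition normalized_analytic :: "(complex \<Rightarrow> complex) set" where
  "normalized_analytic = {f. f holomorphic_on unit_disc \<and> f 0 = 0 \<and> deriv f 0 = 1}"

definition subordinate :: "(complex \<Rightarrow> complex) \<Rightarrow> (complex \<Rightarrow> complex) \<Rightarrow> bool" where
  "subordinate F G \<longleftrightarrow>
     F holomorphic_on unit_disc \<and> G holomorphic_on unit_disc \<and>
     (\<exists>w. w holomorphic_on unit_disc \<and> w ` unit_disc \<subseteq> unit_disc \<and> w 0 = 0 \<and>
          (\<forall>z\<in>unit_disc. F z = G (w z)))"

(* The library predicate "starlike" leaves the centre existentially quantified; here the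
   centre has to be 1.  Positivity of the complex number deriv \<phi> 0 means that it is real
   with positive real part. *)
definition ma_minda :: "(complex \<Rightarrow> complex) \<Rightarrow> bool" where
  "ma_minda \<phi> \<longleftrightarrow>
     \<phi> holomorphic_on unit_disc \<and> inj_on \<phi> unit_disc \<and>
     (\<forall>z\<in>unit_disc. 0 < Re (\<phi> z)) \<and>
     \<phi> 0 = 1 \<and> deriv \<phi> 0 \<in> \<real> \<and> 0 < Re (deriv \<phi> 0) \<and>
     cnj ` (\<phi> ` unit_disc) = \<phi> ` unit_disc \<and>
     (\<forall>w\<in>\<phi> ` unit_disc. closed_segment 1 w \<subseteq> \<phi> ` unit_disc)"

(* At a zero of f other than the origin the quotient below would have the value 0 (division
   by zero), which is not in the image of a Ma-Minda function; so membership in the class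
   forces f to vanish in the disc only at the origin. *)
definition starlike_class :: "(complex \<Rightarrow> complex) \<Rightarrow> (complex \<Rightarrow> complex) set" where
  "starlike_class \<phi> =
     {f \<in> normalized_analytic.
        subordinate (\<lambda>z. if z = 0 then 1 else z * deriv f z / f z) \<phi>}"

definition local_inverse_at_0 :: "(complex \<Rightarrow> complex) \<Rightarrow> (complex \<Rightarrow> complex) \<Rightarrow> bool" where
  "local_inverse_at_0 f g \<longleftrightarrow>
     g 0 = 0 \<and> (\<forall>\<^sub>F \<omega> in nhds 0. f (g \<omega>) = \<omega>) \<and> (\<forall>\<^sub>F z in nhds 0. g (f z) = z)"

(* The sequence A is indexed from 0, so for a normalized f one has A 0 = 0 and A 1 = 1. *)
definition inverse_coeffs :: "(complex \<Rightarrow> complex) \<Rightarrow> (nat \<Rightarrow> complex) \<Rightarrow> bool" where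
  "inverse_coeffs f A \<longleftrightarrow>
     (\<exists>g. local_inverse_at_0 f g \<and> g has_fps_expansion Abs_fps A)"

end

theory Submission
  imports Defs
begin

text \<open>
  Membership of \<open>f\<close> in the class means that \<open>z f'(z) = f(z) \<phi>(w(z))\<close> for a Schwarz function
  \<open>w(z) = w\<^sub>1 z + w\<^sub>2 z\<^sup>2 + \<dots>\<close>.  Comparing the coefficients of \<open>z\<^sup>2\<close> and \<open>z\<^sup>3\<close> expresses \<open>a\<^sub>2\<close> and
  \<open>a\<^sub>3\<close> by \<open>w\<^sub>1\<close> and \<open>w\<^sub>2\<close>, and comparing coefficients in \<open>f(f\<^sup>-\<^sup>1(\<omega>)) = \<omega>\<close> gives
  \<open>A\<^sub>2 = - a\<^sub>2\<close> and \<open>A\<^sub>3 = 2 a\<^sub>2\<^sup>2 - a\<^sub>3\<close>.  The result is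
  \<open>A\<^sub>2 = - B\<^sub>1 w\<^sub>1\<close> and \<open>A\<^sub>3 - \<mu> A\<^sub>2\<^sup>2 = - (B\<^sub>1 / 2) (w\<^sub>2 - (\<nu> - 1) w\<^sub>1\<^sup>2)\<close>
  (lemma \<open>inverse_coeffs_via_Schwarz_function\<close>).

  So the problem is one about Schwarz functions only.  The Schwarz--Pick inequality at the origin
  for \<open>w(z) / z\<close> says \<open>\<bar>w\<^sub>2\<bar> \<le> 1 - \<bar>w\<^sub>1\<bar>\<^sup>2\<close>; hence
  \<open>\<bar>w\<^sub>2 - t w\<^sub>1\<^sup>2\<bar> \<le> 1 - \<bar>w\<^sub>1\<bar>\<^sup>2 + \<bar>t\<bar> \<bar>w\<^sub>1\<bar>\<^sup>2\<close>, a convex combination of \<open>1\<close> and \<open>\<bar>t\<bar>\<close>, which is at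
  most \<open>max 1 \<bar>t\<bar>\<close>.  The value \<open>1\<close> is attained for \<open>w(z) = z\<^sup>2\<close> and the value \<open>\<bar>t\<bar>\<close> for
  \<open>w(z) = z\<close>.  These two Schwarz functions do come from members of the class, because the
  differential equation above can be solved for every \<open>w\<close> by
  \<open>f(z) = z exp (\<integral>\<^sub>0\<^sup>z (\<phi>(w(\<zeta>)) - 1) / \<zeta> d\<zeta>)\<close> (lemma \<open>starlike_function_exists\<close>).
\<close>

section \<open>The first two coefficients of a Schwarz function\<close>

lemma eventually_nhds_unit_disc:
  assumes "\<And>z. z \<in> unit_disc \<Longrightarrow> P z"
  shows "eventually P (nhds 0)"
  using assms by (auto intro: eventually_mono[OF eventually_nhds_in_open[of unit_disc]])

text \<open>
  Writing \<open>w(z) = z h(z)\<close>, the coefficients in question are \<open>h(0)\<close> and \<open>h'(0)\<close>.  Following \<open>h\<close>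
  by the Moebius transformation that moves \<open>h(0)\<close> to the origin gives a function with derivative
  \<open>h'(0) / (1 - \<bar>h(0)\<bar>\<^sup>2)\<close> at the origin, and the Schwarz lemma bounds it by \<open>1\<close>.  This needs
  \<open>\<bar>h\<bar> < 1\<close>, which fails only if \<open>w\<close> is a rotation; then both sides of the claim are \<open>0\<close>.
\<close>

lemma Schwarz_function_second_coeff:
  assumes hol: "w holomorphic_on unit_disc" and im: "w ` unit_disc \<subseteq> unit_disc"
    and w0: "w 0 = 0" and W: "w has_fps_expansion W"
  shows "cmod (fps_nth W 2) \<le> 1 - (cmod (fps_nth W 1))\<^sup>2"
proof -
  have less: "norm (w z) < 1" if "norm z < 1" for z
    using im that by (metis image_subset_iff mem_ball_0)
  obtain h where h: "h holomorphic_on unit_disc"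
    and wh: "\<And>z. norm z < 1 \<Longrightarrow> w z = z * h z" and dw: "deriv w 0 = h 0"
    using Schwarz3[OF hol w0] by blast
  have H: "h has_fps_expansion fps_expansion h 0" (is "_ has_fps_expansion ?H")
    using h by (intro has_fps_expansion_fps_expansion[of unit_disc]) auto
  have "eventually (\<lambda>z. w z = z * h z) (nhds 0)"
    by (rule eventually_nhds_unit_disc) (auto simp: wh)
  then have "w has_fps_expansion fps_X * ?H"
    using has_fps_expansion_mult[OF has_fps_expansion_fps_X H]
    by (subst has_fps_expansion_cong) auto
  then have WH: "W = fps_X * ?H"
    using W fps_expansion_unique_complex by blast
  have W1: "fps_nth W 1 = h 0" and W2: "fps_nth W 2 = deriv h 0"
    using fps_nth_fps_expansion[OF H, of 0] fps_nth_fps_expansion[OF H, of 1]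
    by (simp_all add: WH)
  let ?rot = "(\<exists>z. norm z < 1 \<and> z \<noteq> 0 \<and> norm (w z) = norm z) \<or> norm (deriv w 0) = 1"
  show ?thesis
  proof (cases ?rot)
    case True
    then obtain c where c: "\<And>z. norm z < 1 \<Longrightarrow> w z = c * z" "norm c = 1"
      using Schwarz_Lemma(3)[OF hol w0 less, of 0] by auto
    have "eventually (\<lambda>z. w z = c * z) (nhds 0)"
      by (rule eventually_nhds_unit_disc) (auto simp: c)
    then have "w has_fps_expansion fps_const c * fps_X"
      using has_fps_expansion_cmult_left[OF has_fps_expansion_fps_X, of c]
      by (subst has_fps_expansion_cong) auto
    then have "W = fps_const c * fps_X"
      using W fps_expansion_unique_complex by blast
    then show ?thesis
      using c(2) by simp
  next
    case False
    have hless: "norm (h z) < 1" if "norm z < 1" for z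
    proof (cases "z = 0")
      case True
      have "norm (deriv w 0) \<le> 1"
        using Schwarz_Lemma(2)[OF hol w0 less, of 0] by simp
      then show ?thesis
        using False dw True by auto
    next
      case nz: False
      have "norm (w z) \<le> norm z"
        using Schwarz_Lemma(1)[OF hol w0 less that] .
      moreover have "norm (w z) \<noteq> norm z"
        using False nz that by blast
      ultimately have "norm z * norm (h z) < norm z * 1"
        using wh[OF that] by (simp add: norm_mult)
      then show ?thesis
        using nz by simp
    qed
    define a where "a = h 0"
    have a: "norm a < 1"
      using hless[of 0] by (simp add: a_def)
    define G where "G = (\<lambda>z. Moebius_function 0 a (h z))"
    have "Moebius_function 0 a \<circ> h holomorphic_on unit_disc"
      by (rule holomorphic_on_compose_gen[OF h Moebius_function_holomorphic[OF a]])
        (use hless in auto)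
    then have G: "G holomorphic_on unit_disc"
      by (simp add: G_def o_def)
    have dG: "norm (deriv G 0) \<le> 1"
      by (rule Schwarz_Lemma(2)[OF G, of 0])
        (auto simp: G_def Moebius_function_eq_zero a_def[symmetric]
          intro!: Moebius_function_norm_lt_1 a hless)
    have aa: "a * cnj a = of_real ((norm a)\<^sup>2)"
      by (simp add: complex_norm_square del: of_real_power)
    have pos: "(norm a)\<^sup>2 < 1"
      using a by (simp add: power_less_one_iff)
    have nz: "1 - cnj a * a \<noteq> 0"
    proof
      assume "1 - cnj a * a = 0"
      then have "of_real ((norm a)\<^sup>2) = (of_real 1 :: complex)"
        using aa by (simp add: mult.commute)
      then show False
        using pos by (simp only: of_real_eq_iff)
    qed
    have hd: "(h has_field_derivative deriv h 0) (at 0)"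
      using h by (intro holomorphic_derivI[of _ unit_disc]) auto
    have "((\<lambda>z. (h z - a) / (1 - cnj a * h z)) has_field_derivative
             deriv h 0 / (1 - cnj a * a)) (at 0)"
      by (rule derivative_eq_intros hd refl | use nz a_def in \<open>simp\<close>)+
    then have "deriv G 0 = deriv h 0 / (1 - cnj a * a)"
      unfolding G_def Moebius_function_simple by (rule DERIV_imp_deriv)
    moreover have "1 - cnj a * a = of_real (1 - (norm a)\<^sup>2)"
      using aa by (simp add: mult.commute)
    ultimately have "norm (deriv G 0) = norm (deriv h 0) / (1 - (norm a)\<^sup>2)"
      using pos by (simp only: norm_divide norm_of_real)
    with dG pos have "norm (deriv h 0) \<le> 1 - (norm a)\<^sup>2"
      by (simp add: divide_simps)
    then show ?thesis
      by (simp only: W1 W2 a_def)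
  qed
qed

lemma Schwarz_function_Fekete_Szego:
  assumes "w holomorphic_on unit_disc" and "w ` unit_disc \<subseteq> unit_disc"
    and "w 0 = 0" and "w has_fps_expansion W"
  shows "cmod (fps_nth W 2 - t * (fps_nth W 1)\<^sup>2) \<le> max 1 (cmod t)"
proof -
  define x where "x = (cmod (fps_nth W 1))\<^sup>2"
  have W2: "cmod (fps_nth W 2) \<le> 1 - x"
    unfolding x_def by (rule Schwarz_function_second_coeff[OF assms])
  then have "0 \<le> 1 - x"
    using norm_ge_zero[of "fps_nth W 2"] by linarith
  have "cmod (fps_nth W 2 - t * (fps_nth W 1)\<^sup>2) \<le> cmod (fps_nth W 2) + cmod t * x"
    using norm_triangle_ineq4[of "fps_nth W 2" "t * (fps_nth W 1)\<^sup>2"]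
    by (simp add: norm_mult norm_power x_def)
  also have "\<dots> \<le> (1 - x) * 1 + x * cmod t"
    using W2 by (simp add: mult.commute)
  also have "\<dots> \<le> (1 - x) * max 1 (cmod t) + x * max 1 (cmod t)"
    using \<open>0 \<le> 1 - x\<close> by (intro add_mono mult_left_mono) (auto simp: x_def)
  also have "\<dots> = max 1 (cmod t)"
    by (simp add: algebra_simps)
  finally show ?thesis .
qed

section \<open>Coefficients of the inverse function\<close>

lemma fps_compose_nth_le_3:
  fixes P W :: "complex fps"
  assumes "fps_nth W 0 = 0"
  shows "fps_nth (fps_compose P W) 0 = fps_nth P 0"
    and "fps_nth (fps_compose P W) 1 = fps_nth P 1 * fps_nth W 1"
    and "fps_nth (fps_compose P W) 2 = fps_nth P 1 * fps_nth W 2 + fps_nth P 2 * (fps_nth W 1)\<^sup>2"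
    and "fps_nth (fps_compose P W) 3 = fps_nth P 1 * fps_nth W 3
           + 2 * fps_nth P 2 * fps_nth W 1 * fps_nth W 2 + fps_nth P 3 * (fps_nth W 1) ^ 3"
proof -
  have W2: "fps_nth (W ^ 2) 2 = (fps_nth W 1)\<^sup>2"
    "fps_nth (W ^ 2) 3 = 2 * fps_nth W 1 * fps_nth W 2"
    using assms by (simp_all add: power2_eq_square fps_mult_nth eval_nat_numeral(2,3))
  have W3: "fps_nth (W ^ 3) 3 = (fps_nth W 1) ^ 3"
    using assms by (simp add: power3_eq_cube fps_mult_nth eval_nat_numeral(2,3))
  have sum2: "fps_nth (fps_compose P W) 2 = (\<Sum>i\<in>{0, 1, 2}. fps_nth P i * fps_nth (W ^ i) 2)"
    and sum3: "fps_nth (fps_compose P W) 3 = (\<Sum>i\<in>{0, 1, 2, 3}. fps_nth P i * fps_nth (W ^ i) 3)"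
    by (simp_all add: fps_compose_nth numeral_eq_Suc)
  show "fps_nth (fps_compose P W) 0 = fps_nth P 0"
    by simp
  show "fps_nth (fps_compose P W) 1 = fps_nth P 1 * fps_nth W 1"
    by (simp add: fps_compose_nth)
  show "fps_nth (fps_compose P W) 2 = fps_nth P 1 * fps_nth W 2 + fps_nth P 2 * (fps_nth W 1)\<^sup>2"
    by (simp add: sum2 W2)
  show "fps_nth (fps_compose P W) 3 = fps_nth P 1 * fps_nth W 3
           + 2 * fps_nth P 2 * fps_nth W 1 * fps_nth W 2 + fps_nth P 3 * (fps_nth W 1) ^ 3"
    by (simp add: sum3 W2 W3)
qed

lemma local_inverse_coeffs:
  assumes F: "f has_fps_expansion F" and G: "g has_fps_expansion G"
    and inv: "local_inverse_at_0 f g"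
    and F0: "fps_nth F 0 = 0" and F1: "fps_nth F 1 = 1"
  shows "fps_nth G 2 = - fps_nth F 2"
    and "fps_nth G 3 = 2 * (fps_nth F 2)\<^sup>2 - fps_nth F 3"
proof -
  have G0: "fps_nth G 0 = 0"
    using has_fps_expansion_imp_0_eq_fps_nth_0[OF G] inv by (simp add: local_inverse_at_0_def)
  have "(f \<circ> g) has_fps_expansion fps_compose F G"
    by (rule has_fps_expansion_compose[OF F G G0])
  moreover have "(f \<circ> g) has_fps_expansion fps_X"
    using inv has_fps_expansion_fps_X
    by (subst has_fps_expansion_cong[of _ "\<lambda>z. z"]) (auto simp: local_inverse_at_0_def)
  ultimately have X: "fps_compose F G = fps_X"
    using fps_expansion_unique_complex by blast
  note nth = fps_compose_nth_le_3[OF G0, of F, unfolded X]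
  have G1: "fps_nth G 1 = 1"
    using nth(2) F1 by simp
  show G2: "fps_nth G 2 = - fps_nth F 2"
    using nth(3) F1 G1 by (simp add: eq_neg_iff_add_eq_0)
  show "fps_nth G 3 = 2 * (fps_nth F 2)\<^sup>2 - fps_nth F 3"
    using nth(4) F1 G1 G2 by (simp add: power2_eq_square algebra_simps)
qed

lemma inverse_coeffs_exists:
  assumes f: "f \<in> normalized_analytic"
  shows "\<exists>A. inverse_coeffs f A"
proof -
  have hol: "f holomorphic_on unit_disc" and f0: "f 0 = 0" and df: "deriv f 0 \<noteq> 0"
    using f by (auto simp: normalized_analytic_def)
  obtain r where r: "r > 0" "ball 0 r \<subseteq> unit_disc" "open (f ` ball 0 r)" "inj_on f (ball 0 r)"
    using has_complex_derivative_locally_invertible[OF hol _ _ df] by auto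
  obtain g where g: "g holomorphic_on f ` ball 0 r"
    and gf: "\<And>z. z \<in> ball 0 r \<Longrightarrow> g (f z) = z"
    by (rule holomorphic_has_inverse[OF holomorphic_on_subset[OF hol r(2)] open_ball r(4)])
      (rule that; simp)
  have 0: "0 \<in> f ` ball 0 r"
    using f0 r(1) by (metis centre_in_ball image_eqI)
  have "eventually (\<lambda>z. z \<in> ball 0 r) (nhds (0::complex))"
    using r(1) by (intro eventually_nhds_in_open) auto
  then have "eventually (\<lambda>z. g (f z) = z) (nhds 0)"
    by eventually_elim (rule gf)
  moreover have "eventually (\<lambda>z. f (g z) = z) (nhds 0)"
    using eventually_nhds_in_open[OF r(3) 0] by eventually_elim (auto simp: gf)
  moreover have "g 0 = 0"
    using gf[of 0] f0 r(1) by simp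
  ultimately have "local_inverse_at_0 f g"
    by (simp add: local_inverse_at_0_def)
  moreover have "g has_fps_expansion Abs_fps (fps_nth (fps_expansion g 0))"
    using has_fps_expansion_fps_expansion[OF r(3) 0 g] by (simp add: fps_nth_inverse)
  ultimately show ?thesis
    unfolding inverse_coeffs_def by blast
qed

section \<open>From the class to Schwarz functions and back\<close>

text \<open>
  The equation \<open>z f' = f (\<phi> \<circ> w)\<close> turns into an identity of power series, from which
  \<open>a\<^sub>2 = B\<^sub>1 w\<^sub>1\<close> and \<open>2 a\<^sub>3 = a\<^sub>2 B\<^sub>1 w\<^sub>1 + B\<^sub>1 w\<^sub>2 + B\<^sub>2 w\<^sub>1\<^sup>2\<close> can be read off.
\<close>

lemma inverse_coeffs_via_Schwarz_function:
  assumes f: "f \<in> normalized_analytic"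
    and P: "\<phi> has_fps_expansion Abs_fps B" and \<phi>0: "\<phi> 0 = 1" and B1: "B 1 \<noteq> 0"
    and pos: "\<forall>z\<in>unit_disc. 0 < Re (\<phi> z)"
    and im: "w ` unit_disc \<subseteq> unit_disc" and w0: "w 0 = 0" and W: "w has_fps_expansion W"
    and eq: "\<forall>z\<in>unit_disc. (if z = 0 then 1 else z * deriv f z / f z) = \<phi> (w z)"
    and A: "inverse_coeffs f A"
  shows "A 2 = - B 1 * fps_nth W 1"
    and "A 3 - \<mu> * (A 2)\<^sup>2 = - (B 1 / 2) *
           (fps_nth W 2 - ((3 - 2 * \<mu>) * (B 1)\<^sup>2 - B 2) / B 1 * (fps_nth W 1)\<^sup>2)"
proof -
  have hol: "f holomorphic_on unit_disc" and f0: "f 0 = 0" and df: "deriv f 0 = 1"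
    using f by (auto simp: normalized_analytic_def)
  have F: "f has_fps_expansion fps_expansion f 0" (is "_ has_fps_expansion ?F")
    using hol by (intro has_fps_expansion_fps_expansion[of unit_disc]) auto
  have F0: "fps_nth ?F 0 = 0" and F1: "fps_nth ?F 1 = 1"
    using fps_nth_fps_expansion[OF F, of 0] fps_nth_fps_expansion[OF F, of 1] f0 df by simp_all
  have W0: "fps_nth W 0 = 0"
    using has_fps_expansion_imp_0_eq_fps_nth_0[OF W] w0 by simp
  have B0: "B 0 = 1"
    using has_fps_expansion_imp_0_eq_fps_nth_0[OF P] \<phi>0 by simp
  have ode: "z * deriv f z = f z * \<phi> (w z)" if z: "z \<in> unit_disc" for z
  proof (cases "z = 0")
    case False
    \<comment> \<open>At a zero of \<open>f\<close> the quotient would be \<open>0\<close>, but the values of \<open>\<phi>\<close> have positive real part.\<close>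
    have "0 < Re (\<phi> (w z))"
      using im z pos by blast
    then have "f z \<noteq> 0"
      using bspec[OF eq z] False by auto
    then show ?thesis
      using bspec[OF eq z] False by (simp add: field_simps)
  qed (simp add: f0)
  have "(\<lambda>z. f z * (\<phi> \<circ> w) z) has_fps_expansion ?F * fps_compose (Abs_fps B) W"
    by (intro has_fps_expansion_mult F has_fps_expansion_compose P W W0)
  moreover have "eventually (\<lambda>z. z * deriv f z = f z * (\<phi> \<circ> w) z) (nhds 0)"
    by (rule eventually_nhds_unit_disc) (auto simp: ode)
  moreover have "(\<lambda>z. z * deriv f z) has_fps_expansion fps_X * fps_deriv ?F"
    by (intro has_fps_expansion_mult has_fps_expansion_fps_X has_fps_expansion_deriv F)
  ultimately have series: "fps_X * fps_deriv ?F = ?F * fps_compose (Abs_fps B) W"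
    using fps_expansion_unique_complex has_fps_expansion_cong by metis
  define b where "b n = fps_nth (fps_compose (Abs_fps B) W) n" for n
  define a where "a n = fps_nth ?F n" for n
  define w1 where "w1 = fps_nth W 1"
  define w2 where "w2 = fps_nth W 2"
  have rec: "of_nat n * a n = (\<Sum>i=0..n. a i * b (n - i))" for n
  proof -
    have "of_nat n * a n = fps_nth (fps_X * fps_deriv ?F) n"
      by (cases n) (simp_all add: a_def)
    then show ?thesis
      by (simp add: series fps_mult_nth a_def b_def)
  qed
  have sums: "(\<Sum>i=0..2. c i) = c 0 + c 1 + c 2" "(\<Sum>i=0..3. c i) = c 0 + c 1 + c 2 + c 3"
    for c :: "nat \<Rightarrow> complex"
    by (simp_all add: eval_nat_numeral)
  have b: "b 0 = 1" "b 1 = B 1 * w1" "b 2 = B 1 * w2 + B 2 * w1\<^sup>2"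
    using fps_compose_nth_le_3[OF W0, of "Abs_fps B"] B0 by (simp_all add: b_def w1_def w2_def)
  have a01: "a 0 = 0" "a 1 = 1"
    using F0 F1 by (simp_all add: a_def)
  have "2 * a 2 = a 0 * b 2 + a 1 * b 1 + a 2 * b 0"
    using rec[of 2] by (simp add: sums)
  then have a2: "a 2 = B 1 * w1"
    by (simp add: b a01 del: One_nat_def)
  have "3 * a 3 = a 0 * b 3 + a 1 * b 2 + a 2 * b 1 + a 3 * b 0"
    using rec[of 3] by (simp add: sums)
  then have a3: "a 3 = (B 1 * w2 + B 2 * w1\<^sup>2 + (B 1)\<^sup>2 * w1\<^sup>2) / 2"
    by (simp add: b a01 a2 power2_eq_square algebra_simps del: One_nat_def)
  obtain g where g: "local_inverse_at_0 f g" "g has_fps_expansion Abs_fps A"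
    using A by (auto simp: inverse_coeffs_def)
  have A2: "A 2 = - a 2" and A3: "A 3 = 2 * (a 2)\<^sup>2 - a 3"
    using local_inverse_coeffs[OF F g(2,1) F0 F1] by (simp_all add: a_def)
  show "A 2 = - B 1 * fps_nth W 1"
    by (simp add: A2 a2 w1_def)
  have "A 3 - \<mu> * (A 2)\<^sup>2
      = - (B 1 / 2) * (w2 - ((3 - 2 * \<mu>) * (B 1)\<^sup>2 - B 2) / B 1 * w1\<^sup>2)"
    using B1 by (simp add: A2 A3 a2 a3 field_simps power2_eq_square del: One_nat_def)
  then show "A 3 - \<mu> * (A 2)\<^sup>2 = - (B 1 / 2) *
           (fps_nth W 2 - ((3 - 2 * \<mu>) * (B 1)\<^sup>2 - B 2) / B 1 * (fps_nth W 1)\<^sup>2)"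
    by (simp only: w1_def w2_def)
qed

text \<open>
  With \<open>H\<close> a primitive of \<open>(\<phi>(w(z)) - 1) / z\<close>, whose singularity at the origin is removable, the
  function \<open>z exp (H(z))\<close> has the logarithmic derivative \<open>1 / z + H'(z) = \<phi>(w(z)) / z\<close>.
\<close>

lemma starlike_function_exists:
  assumes \<phi>: "\<phi> holomorphic_on unit_disc" and \<phi>0: "\<phi> 0 = 1"
    and hol: "w holomorphic_on unit_disc" and im: "w ` unit_disc \<subseteq> unit_disc" and w0: "w 0 = 0"
  obtains f where "f \<in> starlike_class \<phi>"
    and "\<forall>z\<in>unit_disc. (if z = 0 then 1 else z * deriv f z / f z) = \<phi> (w z)"
proof -
  have hol': "(\<lambda>z. \<phi> (w z)) holomorphic_on unit_disc"
    using holomorphic_on_compose_gen[OF hol \<phi> im] by (simp add: o_def)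
  have "(\<lambda>z. \<phi> (w z) - 1) holomorphic_on unit_disc" and "\<phi> (w 0) - 1 = 0"
    using hol' by (auto intro!: holomorphic_intros simp: w0 \<phi>0)
  then obtain h where h: "h holomorphic_on unit_disc"
    and h_eq: "\<And>z. norm z < 1 \<Longrightarrow> \<phi> (w z) - 1 = z * h z"
    using Schwarz3[of "\<lambda>z. \<phi> (w z) - 1" 1] by blast
  obtain H0 where H0: "\<And>z. z \<in> unit_disc \<Longrightarrow> (H0 has_field_derivative h z) (at z within unit_disc)"
    using holomorphic_convex_primitive'[OF convex_ball open_ball h] by blast
  define H where "H z = H0 z - H0 0" for z
  have H: "(H has_field_derivative h z) (at z)" if "z \<in> unit_disc" for z
  proof -
    have "(H0 has_field_derivative h z) (at z)"
      using H0[OF that] that by (simp add: at_within_open[OF that open_ball])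
    then show ?thesis
      unfolding H_def by (auto intro!: derivative_eq_intros)
  qed
  define f where "f z = z * exp (H z)" for z
  have f': "(f has_field_derivative exp (H z) * \<phi> (w z)) (at z)" if z: "z \<in> unit_disc" for z
  proof -
    have "\<phi> (w z) = 1 + z * h z"
      using h_eq[of z] z by (simp add: algebra_simps)
    then show ?thesis
      unfolding f_def using H[OF z] by (auto intro!: derivative_eq_intros simp: algebra_simps)
  qed
  have f_hol: "f holomorphic_on unit_disc"
    using f' by (subst holomorphic_on_open) blast+
  have df: "deriv f z = exp (H z) * \<phi> (w z)" if "z \<in> unit_disc" for z
    by (rule DERIV_imp_deriv[OF f'[OF that]])
  have eq: "(if z = 0 then 1 else z * deriv f z / f z) = \<phi> (w z)" if "z \<in> unit_disc" for z
    using df[OF that] w0 \<phi>0 by (simp add: f_def)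
  have "f \<in> normalized_analytic"
    using f_hol df[of 0] by (simp add: normalized_analytic_def f_def H_def w0 \<phi>0)
  moreover have "(\<lambda>z. if z = 0 then 1 else z * deriv f z / f z) holomorphic_on unit_disc"
    using hol' by (rule holomorphic_transform) (simp add: eq)
  then have "subordinate (\<lambda>z. if z = 0 then 1 else z * deriv f z / f z) \<phi>"
    unfolding subordinate_def using \<phi> hol im w0 eq by blast
  ultimately have "f \<in> starlike_class \<phi>"
    by (simp add: starlike_class_def)
  then show thesis
    using eq that by blast
qed

section \<open>The sharp bounds\<close>

theorem theorem2p1:
  fixes \<phi> :: "complex \<Rightarrow> complex" and B :: "nat \<Rightarrow> complex"
  assumes "ma_minda \<phi>"
    and "\<phi> has_fps_expansion Abs_fps B"
  shows
    "(\<forall>\<mu> :: complex.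
        let \<nu> = 1 / B 1 * ((3 - 2 * \<mu>) * (B 1)\<^sup>2 + B 1 - B 2) in
          (\<forall>f \<in> starlike_class \<phi>. \<forall>A. inverse_coeffs f A \<longrightarrow>
             cmod (A 3 - \<mu> * (A 2)\<^sup>2) \<le> Re (B 1) / 2 * max 1 (cmod (\<nu> - 1))) \<and>
          (\<exists>f \<in> starlike_class \<phi>. \<exists>A. inverse_coeffs f A \<and>
             cmod (A 3 - \<mu> * (A 2)\<^sup>2) = Re (B 1) / 2 * max 1 (cmod (\<nu> - 1))))
     \<and>
     ((\<forall>f \<in> starlike_class \<phi>. \<forall>A. inverse_coeffs f A \<longrightarrow> cmod (A 2) \<le> Re (B 1)) \<and>
      (\<exists>f \<in> starlike_class \<phi>. \<exists>A. inverse_coeffs f A \<and> cmod (A 2) = Re (B 1)))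
     \<and>
     ((\<forall>f \<in> starlike_class \<phi>. \<forall>A. inverse_coeffs f A \<longrightarrow>
         cmod (A 3) \<le> Re (B 1) / 2 * max 1 (1 / Re (B 1) * cmod (3 * (B 1)\<^sup>2 - B 2))) \<and>
      (\<exists>f \<in> starlike_class \<phi>. \<exists>A. inverse_coeffs f A \<and>
         cmod (A 3) = Re (B 1) / 2 * max 1 (1 / Re (B 1) * cmod (3 * (B 1)\<^sup>2 - B 2))))"
proof -
  have \<phi>: "\<phi> holomorphic_on unit_disc" and \<phi>0: "\<phi> 0 = 1"
    and re: "\<forall>z\<in>unit_disc. 0 < Re (\<phi> z)"
    and d: "deriv \<phi> 0 \<in> \<real>" "0 < Re (deriv \<phi> 0)"
    using assms(1) by (auto simp: ma_minda_def)
  have "B 1 = deriv \<phi> 0"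
    using fps_nth_fps_expansion[OF assms(2), of 1] by simp
  then have B1: "B 1 = of_real (Re (B 1))" and pos: "0 < Re (B 1)"
    using d by simp_all
  then have nz: "B 1 \<noteq> 0" and norm_B1: "cmod (B 1) = Re (B 1)"
    by (auto, metis abs_of_pos norm_of_real)
  define t where "t \<mu> = ((3 - 2 * \<mu>) * (B 1)\<^sup>2 - B 2) / B 1" for \<mu>
  have t: "1 / B 1 * ((3 - 2 * \<mu>) * (B 1)\<^sup>2 + B 1 - B 2) - 1 = t \<mu>" for \<mu>
    using nz by (simp add: t_def field_simps)
  note coeffs = inverse_coeffs_via_Schwarz_function[OF _ assms(2) \<phi>0 nz re, folded t_def]

  have upper: "cmod (A 2) \<le> Re (B 1)
      \<and> cmod (A 3 - \<mu> * (A 2)\<^sup>2) \<le> Re (B 1) / 2 * max 1 (cmod (t \<mu>))"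
    if f: "f \<in> starlike_class \<phi>" and A: "inverse_coeffs f A" for f A \<mu>
  proof -
    obtain w where w: "w holomorphic_on unit_disc" "w ` unit_disc \<subseteq> unit_disc" "w 0 = 0"
      and eq: "\<forall>z\<in>unit_disc. (if z = 0 then 1 else z * deriv f z / f z) = \<phi> (w z)"
      using f unfolding starlike_class_def subordinate_def by blast
    have W: "w has_fps_expansion fps_expansion w 0" (is "_ has_fps_expansion ?W")
      using w(1) by (intro has_fps_expansion_fps_expansion[of unit_disc]) auto
    have fn: "f \<in> normalized_analytic"
      using f by (simp add: starlike_class_def)
    note c = coeffs[OF fn w(2,3) W eq A]
    have "(cmod (fps_nth ?W 1))\<^sup>2 \<le> 1"
      using Schwarz_function_second_coeff[OF w W] norm_ge_zero[of "fps_nth ?W 2"] by linarith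
    then have "cmod (fps_nth ?W 1) \<le> 1"
      by (simp add: power_le_one_iff)
    then have "Re (B 1) * cmod (fps_nth ?W 1) \<le> Re (B 1) * 1"
      using pos by (intro mult_left_mono) auto
    then have "cmod (A 2) \<le> Re (B 1)"
      by (simp only: c(1) norm_mult norm_minus_cancel norm_B1 mult_1_right)
    moreover have "cmod (A 3 - \<mu> * (A 2)\<^sup>2)
        = Re (B 1) / 2 * cmod (fps_nth ?W 2 - t \<mu> * (fps_nth ?W 1)\<^sup>2)"
      by (simp only: c(2) norm_mult norm_minus_cancel norm_divide norm_B1 norm_numeral)
    moreover have "\<dots> \<le> Re (B 1) / 2 * max 1 (cmod (t \<mu>))"
      using pos by (intro mult_left_mono Schwarz_function_Fekete_Szego[OF w W]) auto
    ultimately show ?thesis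
      by simp
  qed

  \<comment> \<open>The Schwarz function \<open>w(z) = z\<^sup>k\<close> has the power series \<open>X\<^sup>k\<close>; the cases \<open>k = 1\<close> and \<open>k = 2\<close> are extremal.\<close>
  have attained: "\<exists>f \<in> starlike_class \<phi>. \<exists>A. inverse_coeffs f A \<and>
      cmod (A 2) = Re (B 1) * cmod (fps_nth (fps_X ^ k) 1) \<and>
      (\<forall>\<mu>. cmod (A 3 - \<mu> * (A 2)\<^sup>2)
        = Re (B 1) / 2 * cmod (fps_nth (fps_X ^ k) 2 - t \<mu> * (fps_nth (fps_X ^ k) 1)\<^sup>2))"
    if k: "k > 0" for k :: nat
  proof -
    have w: "(\<lambda>z::complex. z ^ k) holomorphic_on unit_disc"
      "(\<lambda>z::complex. z ^ k) ` unit_disc \<subseteq> unit_disc" "(0::complex) ^ k = 0"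
      using k by (auto intro!: holomorphic_intros simp: norm_power power_less_one_iff)
    obtain f where f: "f \<in> starlike_class \<phi>"
      and eq: "\<forall>z\<in>unit_disc. (if z = 0 then 1 else z * deriv f z / f z) = \<phi> (z ^ k)"
      using starlike_function_exists[OF \<phi> \<phi>0 w] by blast
    have fn: "f \<in> normalized_analytic"
      using f by (simp add: starlike_class_def)
    obtain A where A: "inverse_coeffs f A"
      using inverse_coeffs_exists[OF fn] by blast
    note c = coeffs[OF fn w(2,3) has_fps_expansion_fps_X_power eq A]
    have "cmod (A 2) = Re (B 1) * cmod (fps_nth (fps_X ^ k) 1)"
      by (simp only: c(1) norm_mult norm_minus_cancel norm_B1)
    moreover have "cmod (A 3 - \<mu> * (A 2)\<^sup>2)
        = Re (B 1) / 2 * cmod (fps_nth (fps_X ^ k) 2 - t \<mu> * (fps_nth (fps_X ^ k) 1)\<^sup>2)" for \<mu>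
      by (simp only: c(2) norm_mult norm_minus_cancel norm_divide norm_B1 norm_numeral)
    ultimately show ?thesis
      using f A by blast
  qed

  have sharp: "\<exists>f \<in> starlike_class \<phi>. \<exists>A. inverse_coeffs f A \<and>
      cmod (A 3 - \<mu> * (A 2)\<^sup>2) = Re (B 1) / 2 * max 1 (cmod (t \<mu>))" for \<mu>
  proof (cases "cmod (t \<mu>) \<le> 1")
    case True
    have "max 1 (cmod (t \<mu>)) = cmod (fps_nth (fps_X ^ 2) 2 - t \<mu> * (fps_nth (fps_X ^ 2) 1)\<^sup>2)"
      using True by (simp add: fps_X_power_iff)
    then show ?thesis
      using attained[of 2] by (metis zero_less_numeral)
  next
    case False
    have "max 1 (cmod (t \<mu>)) = cmod (fps_nth (fps_X ^ 1) 2 - t \<mu> * (fps_nth (fps_X ^ 1) 1)\<^sup>2)"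
      using False by (simp add: fps_X_power_iff)
    then show ?thesis
      using attained[of 1] by (metis zero_less_one)
  qed
  have sharp2: "\<exists>f \<in> starlike_class \<phi>. \<exists>A. inverse_coeffs f A \<and> cmod (A 2) = Re (B 1)"
    using attained[of 1] by fastforce

  \<comment> \<open>The bound for \<open>A\<^sub>3\<close> is the case \<open>\<mu> = 0\<close>, up to writing \<open>B\<^sub>1\<close> as a positive real number.\<close>
  have t0: "1 / Re (B 1) * cmod (3 * (B 1)\<^sup>2 - B 2) = cmod (t 0)"
    by (simp add: t_def norm_divide norm_B1 del: One_nat_def)
  show ?thesis
    unfolding Let_def t t0 using upper[of _ _ 0] upper sharp sharp[of 0] sharp2 by simp
qed

end
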